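(* Let $\mathbb{A}$ be a finitely generated $L$-structure, $L$ a finite language, satisfying: (i) $\mathbb{A}$ is either finitely presented or equationally Noetherian; (ii) $\mathbb{A}$ is Hopfian; (iii) $\mathbb{A}$ has definable $n$-generation for some $n\in\mathbb{N}$. Then $\mathbb{A}$ is prime.
   Context: $\mathbb{A}$ is Hopfian if every surjective homomorphism $\mathbb{A}\to\mathbb{A}$ is an automorphism. $\mathbb{A}$ is equationally Noetherian if for every $n$ every system of equations in variables $x_1,\dots,x_n$ with coefficients from $\mathbb{A}$ is equivalent over $\mathbb{A}$ to a finite subsystem. A finitely generated $\mathbb{A}$ has definable $n$-generation if there is a first-order $L$-formula $\phi(x_1,\dots,x_n)$ (without parameters) such that some generating $n$-tuple of $\mathbb{A}$ satisfies $\phi$ in $\mathbb{A}$ and every $n$-tuple of $\mathbb{A}$ satisfying $\phi$ generates $\mathbb{A}$. $\mathbb{A}$ is prime if it elementarily embeds into every model of its complete first-order theory $Th(\mathbb{A})$. *)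

theory Defs
  imports Main
begin

section \<open>Languages and structures\<close>

text \<open>The symbols of a language form sets rather than whole types, so that a language may have no
  function symbols or no relation symbols. Constants are function symbols of arity 0.\<close>

record ('f, 'r) language =
  fsyms :: "'f set"
  rsyms :: "'r set"
  farity :: "'f \<Rightarrow> nat"
  rarity :: "'r \<Rightarrow> nat"

definition finite_language :: "('f, 'r) language \<Rightarrow> bool" where
  "finite_language L \<longleftrightarrow> finite (fsyms L) \<and> finite (rsyms L)"

record ('f, 'r, 'a) struct =
  universe :: "'a set"
  finterp :: "'f \<Rightarrow> 'a list \<Rightarrow> 'a"
  rinterp :: "'r \<Rightarrow> 'a list \<Rightarrow> bool"

definition is_struct :: "('f, 'r) language \<Rightarrow> ('f, 'r, 'a) struct \<Rightarrow> bool" where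
  "is_struct L A \<longleftrightarrow> universe A \<noteq> {} \<and>
     (\<forall>f\<in>fsyms L. \<forall>xs. set xs \<subseteq> universe A \<longrightarrow> length xs = farity L f \<longrightarrow>
        finterp A f xs \<in> universe A)"

section \<open>Terms, atomic formulas and first-order formulas\<close>

datatype ('f, 'v) trm = Var 'v | Fn 'f "('f, 'v) trm list"

datatype ('f, 'r, 'v) atom = Eq "('f, 'v) trm" "('f, 'v) trm" | Rel 'r "('f, 'v) trm list"

datatype ('f, 'r) fm =
    Atom "('f, 'r, nat) atom"
  | Neg "('f, 'r) fm"
  | Conj "('f, 'r) fm" "('f, 'r) fm"
  | Ex nat "('f, 'r) fm"

primrec tvars :: "('f, 'v) trm \<Rightarrow> 'v set" where
  "tvars (Var x) = {x}"
| "tvars (Fn f ts) = \<Union> (set (map tvars ts))"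

primrec avars :: "('f, 'r, 'v) atom \<Rightarrow> 'v set" where
  "avars (Eq t u) = tvars t \<union> tvars u"
| "avars (Rel r ts) = \<Union> (tvars ` set ts)"

primrec fvars :: "('f, 'r) fm \<Rightarrow> nat set" where
  "fvars (Atom e) = avars e"
| "fvars (Neg \<phi>) = fvars \<phi>"
| "fvars (Conj \<phi> \<psi>) = fvars \<phi> \<union> fvars \<psi>"
| "fvars (Ex x \<phi>) = fvars \<phi> - {x}"

primrec wf_trm :: "('f, 'r) language \<Rightarrow> ('f, 'v) trm \<Rightarrow> bool" where
  "wf_trm L (Var x) \<longleftrightarrow> True"
| "wf_trm L (Fn f ts) \<longleftrightarrow>
     f \<in> fsyms L \<and> length ts = farity L f \<and> list_all id (map (wf_trm L) ts)"

primrec wf_atom :: "('f, 'r) language \<Rightarrow> ('f, 'r, 'v) atom \<Rightarrow> bool" where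
  "wf_atom L (Eq t u) \<longleftrightarrow> wf_trm L t \<and> wf_trm L u"
| "wf_atom L (Rel r ts) \<longleftrightarrow>
     r \<in> rsyms L \<and> length ts = rarity L r \<and> (\<forall>t\<in>set ts. wf_trm L t)"

primrec wf_fm :: "('f, 'r) language \<Rightarrow> ('f, 'r) fm \<Rightarrow> bool" where
  "wf_fm L (Atom e) \<longleftrightarrow> wf_atom L e"
| "wf_fm L (Neg \<phi>) \<longleftrightarrow> wf_fm L \<phi>"
| "wf_fm L (Conj \<phi> \<psi>) \<longleftrightarrow> wf_fm L \<phi> \<and> wf_fm L \<psi>"
| "wf_fm L (Ex x \<phi>) \<longleftrightarrow> wf_fm L \<phi>"

primrec eval_trm :: "('f, 'r, 'a) struct \<Rightarrow> ('v \<Rightarrow> 'a) \<Rightarrow> ('f, 'v) trm \<Rightarrow> 'a" where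
  "eval_trm A s (Var x) = s x"
| "eval_trm A s (Fn f ts) = finterp A f (map (eval_trm A s) ts)"

primrec sat_atom :: "('f, 'r, 'a) struct \<Rightarrow> ('v \<Rightarrow> 'a) \<Rightarrow> ('f, 'r, 'v) atom \<Rightarrow> bool" where
  "sat_atom A s (Eq t u) \<longleftrightarrow> eval_trm A s t = eval_trm A s u"
| "sat_atom A s (Rel r ts) \<longleftrightarrow> rinterp A r (map (eval_trm A s) ts)"

primrec sat :: "('f, 'r, 'a) struct \<Rightarrow> (nat \<Rightarrow> 'a) \<Rightarrow> ('f, 'r) fm \<Rightarrow> bool" where
  "sat A s (Atom e) \<longleftrightarrow> sat_atom A s e"
| "sat A s (Neg \<phi>) \<longleftrightarrow> \<not> sat A s \<phi>"
| "sat A s (Conj \<phi> \<psi>) \<longleftrightarrow> sat A s \<phi> \<and> sat A s \<psi>"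
| "sat A s (Ex x \<phi>) \<longleftrightarrow> (\<exists>a\<in>universe A. sat A (s(x := a)) \<phi>)"

section \<open>Homomorphisms, generation and the Hopf property\<close>

definition hom :: "('f, 'r) language \<Rightarrow> ('f, 'r, 'a) struct \<Rightarrow> ('f, 'r, 'b) struct \<Rightarrow> ('a \<Rightarrow> 'b) \<Rightarrow> bool"
where
  "hom L A B h \<longleftrightarrow> h ` universe A \<subseteq> universe B \<and>
     (\<forall>f\<in>fsyms L. \<forall>xs. set xs \<subseteq> universe A \<longrightarrow> length xs = farity L f \<longrightarrow>
        h (finterp A f xs) = finterp B f (map h xs)) \<and>
     (\<forall>r\<in>rsyms L. \<forall>xs. set xs \<subseteq> universe A \<longrightarrow> length xs = rarity L r \<longrightarrow>
        rinterp A r xs \<longrightarrow> rinterp B r (map h xs))"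

definition automorphism :: "('f, 'r) language \<Rightarrow> ('f, 'r, 'a) struct \<Rightarrow> ('a \<Rightarrow> 'a) \<Rightarrow> bool" where
  "automorphism L A h \<longleftrightarrow> hom L A A h \<and> bij_betw h (universe A) (universe A) \<and>
     (\<forall>r\<in>rsyms L. \<forall>xs. set xs \<subseteq> universe A \<longrightarrow> length xs = rarity L r \<longrightarrow>
        rinterp A r (map h xs) \<longrightarrow> rinterp A r xs)"

definition hopfian :: "('f, 'r) language \<Rightarrow> ('f, 'r, 'a) struct \<Rightarrow> bool" where
  "hopfian L A \<longleftrightarrow>
     (\<forall>h. hom L A A h \<and> h ` universe A = universe A \<longrightarrow> automorphism L A h)"

inductive_set generated :: "('f, 'r) language \<Rightarrow> ('f, 'r, 'a) struct \<Rightarrow> 'a set \<Rightarrow> 'a set"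
  for L A X where
  base: "x \<in> X \<Longrightarrow> x \<in> generated L A X"
| app: "f \<in> fsyms L \<Longrightarrow> length xs = farity L f \<Longrightarrow> \<forall>x\<in>set xs. x \<in> generated L A X \<Longrightarrow>
    finterp A f xs \<in> generated L A X"

definition generates :: "('f, 'r) language \<Rightarrow> ('f, 'r, 'a) struct \<Rightarrow> 'a set \<Rightarrow> bool" where
  "generates L A X \<longleftrightarrow> X \<subseteq> universe A \<and> generated L A X = universe A"

definition finitely_generated :: "('f, 'r) language \<Rightarrow> ('f, 'r, 'a) struct \<Rightarrow> bool" where
  "finitely_generated L A \<longleftrightarrow> (\<exists>X. finite X \<and> generates L A X)"

text \<open>Here and below, \<open>n\<close>-tuples are lists of length \<open>n\<close>, and the variables
  \<open>x\<^sub>1, \<dots>, x\<^sub>n\<close> are numbered \<open>0, \<dots>, n - 1\<close>.\<close>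

definition definable_generation :: "('f, 'r) language \<Rightarrow> ('f, 'r, 'a) struct \<Rightarrow> nat \<Rightarrow> bool" where
  "definable_generation L A n \<longleftrightarrow> (\<exists>\<phi>. wf_fm L \<phi> \<and> fvars \<phi> \<subseteq> {..<n} \<and>
     (\<exists>as. length as = n \<and> generates L A (set as) \<and> sat A (nth as) \<phi>) \<and>
     (\<forall>as. length as = n \<and> set as \<subseteq> universe A \<and> sat A (nth as) \<phi> \<longrightarrow> generates L A (set as)))"

section \<open>Equationally Noetherian structures\<close>

text \<open>As the language may contain relation symbols, an equation with coefficients from \<open>A\<close> is an
  atomic formula (an equality of terms or a relation symbol applied to terms) of the language
  enriched by the elements of \<open>A\<close> as constants. A leaf \<open>Var (Inl i)\<close> is the \<open>i\<close>-th unknown, a leaf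
  \<open>Var (Inr a)\<close> is the coefficient \<open>a\<close>.\<close>

definition equation_over ::
  "('f, 'r) language \<Rightarrow> ('f, 'r, 'a) struct \<Rightarrow> nat \<Rightarrow> ('f, 'r, nat + 'a) atom \<Rightarrow> bool" where
  "equation_over L A n e \<longleftrightarrow> wf_atom L e \<and> avars e \<subseteq> {..<n} <+> universe A"

definition solutions ::
  "('f, 'r, 'a) struct \<Rightarrow> nat \<Rightarrow> ('f, 'r, nat + 'a) atom set \<Rightarrow> 'a list set" where
  "solutions A n S = {as. length as = n \<and> set as \<subseteq> universe A \<and>
     (\<forall>e\<in>S. sat_atom A (case_sum (nth as) id) e)}"

definition equationally_noetherian :: "('f, 'r) language \<Rightarrow> ('f, 'r, 'a) struct \<Rightarrow> bool" where
  "equationally_noetherian L A \<longleftrightarrow> (\<forall>n S. (\<forall>e\<in>S. equation_over L A n e) \<longrightarrow>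
     (\<exists>S0\<subseteq>S. finite S0 \<and> solutions A n S0 = solutions A n S))"

section \<open>Finitely presented structures\<close>

text \<open>Finite presentability is relative to an ambient quasivariety (for instance, a finitely presented
  group is finitely presented in the variety of groups). A quasi-identity
  \<open>\<forall>x. p\<^sub>1 \<and> \<dots> \<and> p\<^sub>k \<longrightarrow> c\<close> with atomic \<open>p\<^sub>i\<close> and \<open>c\<close> is written as the pair
  \<open>([p\<^sub>1, \<dots>, p\<^sub>k], c)\<close>. Identities are the case \<open>k = 0\<close>, so varieties are included;
  the empty set of quasi-identities gives the class of all structures of the language, i.e. absolute
  finite presentability.\<close>

type_synonym ('f, 'r) quasi_identity = "('f, 'r, nat) atom list \<times> ('f, 'r, nat) atom"

definition wf_quasi_identity :: "('f, 'r) language \<Rightarrow> ('f, 'r) quasi_identity \<Rightarrow> bool" where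
  "wf_quasi_identity L q \<longleftrightarrow> (\<forall>p\<in>set (fst q). wf_atom L p) \<and> wf_atom L (snd q)"

definition sat_quasi_identity :: "('f, 'r, 'a) struct \<Rightarrow> ('f, 'r) quasi_identity \<Rightarrow> bool" where
  "sat_quasi_identity A q \<longleftrightarrow> (\<forall>s. range s \<subseteq> universe A \<longrightarrow>
     (\<forall>p\<in>set (fst q). sat_atom A s p) \<longrightarrow> sat_atom A s (snd q))"

definition in_quasivariety ::
  "('f, 'r) language \<Rightarrow> ('f, 'r) quasi_identity set \<Rightarrow> ('f, 'r, 'a) struct \<Rightarrow> bool" where
  "in_quasivariety L Q B \<longleftrightarrow> is_struct L B \<and> (\<forall>q\<in>Q. sat_quasi_identity B q)"

text \<open>\<open>A\<close> has the presentation with generators \<open>as\<close> and relations \<open>S\<close> in the quasivariety \<open>Q\<close>: it lies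
  in the quasivariety, is generated by \<open>as\<close>, satisfies \<open>S\<close> at \<open>as\<close>, and is universal with these
  properties. The test structures \<open>B\<close> have their universes in the type of terms. This is no restriction:
  a quasivariety is closed under substructures and isomorphic copies, and the substructure of an
  arbitrary structure generated by a finite tuple is in bijection with a set of terms in finitely
  many variables (one term for each element).\<close>

definition presented_by ::
  "('f, 'r) language \<Rightarrow> ('f, 'r) quasi_identity set \<Rightarrow> ('f, 'r, 'a) struct \<Rightarrow>
   'a list \<Rightarrow> ('f, 'r, nat) atom set \<Rightarrow> bool" where
  "presented_by L Q A as S \<longleftrightarrow>
     in_quasivariety L Q A \<and> generates L A (set as) \<and>
     (\<forall>e\<in>S. wf_atom L e \<and> avars e \<subseteq> {..<length as} \<and> sat_atom A (nth as) e) \<and>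
     (\<forall>(B :: ('f, 'r, ('f, nat) trm) struct) bs.
        in_quasivariety L Q B \<and> length bs = length as \<and> set bs \<subseteq> universe B \<and>
        (\<forall>e\<in>S. sat_atom B (nth bs) e) \<longrightarrow> (\<exists>h. hom L A B h \<and> map h as = bs))"

definition finitely_presented_in ::
  "('f, 'r) language \<Rightarrow> ('f, 'r) quasi_identity set \<Rightarrow> ('f, 'r, 'a) struct \<Rightarrow> bool" where
  "finitely_presented_in L Q A \<longleftrightarrow> (\<forall>q\<in>Q. wf_quasi_identity L q) \<and>
     (\<exists>as S. finite S \<and> presented_by L Q A as S)"

section \<open>Complete theories and prime structures\<close>

definition sentence :: "('f, 'r) language \<Rightarrow> ('f, 'r) fm \<Rightarrow> bool" where
  "sentence L \<phi> \<longleftrightarrow> wf_fm L \<phi> \<and> fvars \<phi> = {}"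

definition holds_in :: "('f, 'r, 'a) struct \<Rightarrow> ('f, 'r) fm \<Rightarrow> bool" where
  "holds_in A \<phi> \<longleftrightarrow> (\<forall>s. range s \<subseteq> universe A \<longrightarrow> sat A s \<phi>)"

definition Th :: "('f, 'r) language \<Rightarrow> ('f, 'r, 'a) struct \<Rightarrow> ('f, 'r) fm set" where
  "Th L A = {\<phi>. sentence L \<phi> \<and> holds_in A \<phi>}"

definition is_model :: "('f, 'r) language \<Rightarrow> ('f, 'r) fm set \<Rightarrow> ('f, 'r, 'b) struct \<Rightarrow> bool" where
  "is_model L T B \<longleftrightarrow> is_struct L B \<and> (\<forall>\<phi>\<in>T. holds_in B \<phi>)"

definition elementary_embedding ::
  "('f, 'r) language \<Rightarrow> ('f, 'r, 'a) struct \<Rightarrow> ('f, 'r, 'b) struct \<Rightarrow> ('a \<Rightarrow> 'b) \<Rightarrow> bool" where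
  "elementary_embedding L A B h \<longleftrightarrow> h ` universe A \<subseteq> universe B \<and>
     (\<forall>\<phi> s. wf_fm L \<phi> \<longrightarrow> range s \<subseteq> universe A \<longrightarrow> (sat A s \<phi> \<longleftrightarrow> sat B (h \<circ> s) \<phi>))"

text \<open>HOL cannot quantify over the types of the universes of the models inside a formula, so this
  type is a parameter; a theorem in which \<open>'b\<close> is a type variable covers all models.\<close>

definition prime_struct ::
  "'b itself \<Rightarrow> ('f, 'r) language \<Rightarrow> ('f, 'r, 'a) struct \<Rightarrow> bool" where
  "prime_struct _ L A \<longleftrightarrow> (\<forall>B :: ('f, 'r, 'b) struct.
     is_model L (Th L A) B \<longrightarrow> (\<exists>h. elementary_embedding L A B h))"

end

theory Submission
  imports Defs
begin

text \<open>Let \<open>a\<close> be a generating tuple satisfying the formula \<open>\<phi>\<close> that defines generation.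
  Either alternative of hypothesis (i) provides finitely many atomic formulas \<open>S\<close>, true at \<open>a\<close>, such
  that every tuple \<open>b\<close> of \<open>A\<close> satisfying \<open>S\<close> is the image of \<open>a\<close> under an endomorphism. If \<open>b\<close> also
  satisfies \<open>\<phi>\<close>, this endomorphism is surjective, hence an automorphism by the Hopf property, so \<open>b\<close>
  has the same type as \<open>a\<close>. Thus \<open>\<phi> \<and> \<And>S\<close> isolates the type of \<open>a\<close>; a realization of it in a model
  \<open>B\<close> of \<open>Th(A)\<close> has the type of \<open>a\<close>, and \<open>t(a) \<mapsto> t(b)\<close> is an elementary embedding.\<close>

section \<open>Evaluation and substitution\<close>

text \<open>The bounded quantifier replaces the \<open>list_all id\<close> form forced by nested
  primitive recursion; it fits the induction hypotheses for lists of arguments.\<close>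

lemma wf_trm_Fn:
  "wf_trm L (Fn f ts) \<longleftrightarrow> f \<in> fsyms L \<and> length ts = farity L f \<and> (\<forall>t\<in>set ts. wf_trm L t)"
  by (simp add: list_all_iff)

declare wf_trm.simps(2) [simp del] wf_trm_Fn [simp]

lemma finite_tvars: "finite (tvars t)"
  by (induction t) auto

lemma finite_avars: "finite (avars e)"
  by (cases e) (auto simp: finite_tvars)

lemma finite_fvars: "finite (fvars \<phi>)"
  by (induction \<phi>) (auto simp: finite_avars)

lemma eval_trm_cong: "(\<And>v. v \<in> tvars t \<Longrightarrow> s v = s' v) \<Longrightarrow> eval_trm A s t = eval_trm A s' t"
proof (induction t)
  case (Fn f ts)
  then have "map (eval_trm A s) ts = map (eval_trm A s') ts" by auto
  then show ?case by (simp del: map_eq_conv)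
qed simp

lemma sat_atom_cong: "(\<And>v. v \<in> avars e \<Longrightarrow> s v = s' v) \<Longrightarrow> sat_atom A s e \<longleftrightarrow> sat_atom A s' e"
proof (cases e)
  case (Rel r ts)
  assume "\<And>v. v \<in> avars e \<Longrightarrow> s v = s' v"
  with Rel have "map (eval_trm A s) ts = map (eval_trm A s') ts"
    by (auto intro: eval_trm_cong)
  with Rel show ?thesis by (simp del: map_eq_conv)
next
  case (Eq t u)
  assume "\<And>v. v \<in> avars e \<Longrightarrow> s v = s' v"
  with Eq have "eval_trm A s t = eval_trm A s' t" "eval_trm A s u = eval_trm A s' u"
    by (auto intro!: eval_trm_cong)
  with Eq show ?thesis by simp
qed

lemma sat_cong: "(\<And>v. v \<in> fvars \<phi> \<Longrightarrow> s v = s' v) \<Longrightarrow> sat A s \<phi> \<longleftrightarrow> sat A s' \<phi>"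
proof (induction \<phi> arbitrary: s s')
  case (Atom e)
  then show ?case using sat_atom_cong[of e s s' A] by simp
next
  case (Neg \<phi>)
  show ?case using Neg.IH[of s s'] Neg.prems by simp
next
  case (Conj \<phi> \<psi>)
  show ?case using Conj.IH(1)[of s s'] Conj.IH(2)[of s s'] Conj.prems by simp
next
  case (Ex x \<phi>)
  have "sat A (s(x := a)) \<phi> \<longleftrightarrow> sat A (s'(x := a)) \<phi>" for a
    by (rule Ex.IH) (use Ex.prems in auto)
  then show ?case by simp
qed

lemma eval_trm_in_universe:
  "is_struct L A \<Longrightarrow> wf_trm L t \<Longrightarrow> s ` tvars t \<subseteq> universe A \<Longrightarrow> eval_trm A s t \<in> universe A"
proof (induction t)
  case (Fn f ts)
  then have "set (map (eval_trm A s) ts) \<subseteq> universe A" by fastforce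
  with Fn.prems show ?case by (simp add: is_struct_def)
qed auto

section \<open>Capture-avoiding substitution of terms for variables\<close>

primrec subst_trm :: "('v \<Rightarrow> ('f, 'w) trm) \<Rightarrow> ('f, 'v) trm \<Rightarrow> ('f, 'w) trm" where
  "subst_trm \<sigma> (Var x) = \<sigma> x"
| "subst_trm \<sigma> (Fn f ts) = Fn f (map (subst_trm \<sigma>) ts)"

primrec subst_atom :: "('v \<Rightarrow> ('f, 'w) trm) \<Rightarrow> ('f, 'r, 'v) atom \<Rightarrow> ('f, 'r, 'w) atom" where
  "subst_atom \<sigma> (Eq t u) = Eq (subst_trm \<sigma> t) (subst_trm \<sigma> u)"
| "subst_atom \<sigma> (Rel r ts) = Rel r (map (subst_trm \<sigma>) ts)"

text \<open>To avoid capture, a bound variable is renamed to the least one occurring in no term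
  substituted for a free variable of the body.\<close>

primrec subst_fm :: "('f, 'r) fm \<Rightarrow> (nat \<Rightarrow> ('f, nat) trm) \<Rightarrow> ('f, 'r) fm" where
  "subst_fm (Atom e) \<sigma> = Atom (subst_atom \<sigma> e)"
| "subst_fm (Neg \<phi>) \<sigma> = Neg (subst_fm \<phi> \<sigma>)"
| "subst_fm (Conj \<phi> \<psi>) \<sigma> = Conj (subst_fm \<phi> \<sigma>) (subst_fm \<psi> \<sigma>)"
| "subst_fm (Ex x \<phi>) \<sigma> =
     (let z = (LEAST z. z \<notin> (\<Union>v\<in>fvars \<phi>. tvars (\<sigma> v))) in Ex z (subst_fm \<phi> (\<sigma>(x := Var z))))"

lemma eval_subst_trm: "eval_trm A s (subst_trm \<sigma> t) = eval_trm A (\<lambda>v. eval_trm A s (\<sigma> v)) t"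
proof (induction t)
  case (Fn f ts)
  then have "map (eval_trm A s \<circ> subst_trm \<sigma>) ts = map (eval_trm A (\<lambda>v. eval_trm A s (\<sigma> v))) ts"
    by simp
  then show ?case by (simp del: map_eq_conv)
qed simp

lemma sat_subst_atom: "sat_atom A s (subst_atom \<sigma> e) = sat_atom A (\<lambda>v. eval_trm A s (\<sigma> v)) e"
  by (cases e) (simp_all add: eval_subst_trm comp_def)

lemma wf_subst_trm: "wf_trm L t \<Longrightarrow> \<forall>v\<in>tvars t. wf_trm L (\<sigma> v) \<Longrightarrow> wf_trm L (subst_trm \<sigma> t)"
  by (induction t) auto

lemma wf_subst_atom: "wf_atom L e \<Longrightarrow> \<forall>v\<in>avars e. wf_trm L (\<sigma> v) \<Longrightarrow> wf_atom L (subst_atom \<sigma> e)"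
  by (cases e) (auto intro: wf_subst_trm)

lemma wf_subst_fm: "wf_fm L \<phi> \<Longrightarrow> \<forall>v. wf_trm L (\<sigma> v) \<Longrightarrow> wf_fm L (subst_fm \<phi> \<sigma>)"
proof (induction \<phi> arbitrary: \<sigma>)
  case (Ex x \<phi>)
  then have "wf_fm L (subst_fm \<phi> (\<sigma>(x := Var z)))" for z by simp
  then show ?case by (simp add: Let_def)
qed (simp_all add: wf_subst_atom)

lemma tvars_subst_trm: "tvars (subst_trm \<sigma> t) = (\<Union>v\<in>tvars t. tvars (\<sigma> v))"
  by (induction t) auto

lemma avars_subst_atom: "avars (subst_atom \<sigma> e) = (\<Union>v\<in>avars e. tvars (\<sigma> v))"
  by (cases e) (auto simp: tvars_subst_trm)

lemma fvars_subst_fm: "fvars (subst_fm \<phi> \<sigma>) \<subseteq> (\<Union>v\<in>fvars \<phi>. tvars (\<sigma> v))"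
proof (induction \<phi> arbitrary: \<sigma>)
  case (Atom e)
  then show ?case by (simp add: avars_subst_atom)
next
  case (Neg \<phi>)
  then show ?case by simp
next
  case (Conj \<phi> \<psi>)
  show ?case using Conj.IH[of \<sigma>] by auto
next
  case (Ex x \<phi>)
  define z where "z = (LEAST z. z \<notin> (\<Union>v\<in>fvars \<phi>. tvars (\<sigma> v)))"
  have "subst_fm (Ex x \<phi>) \<sigma> = Ex z (subst_fm \<phi> (\<sigma>(x := Var z)))"
    by (simp add: Let_def z_def)
  then have "fvars (subst_fm (Ex x \<phi>) \<sigma>) \<subseteq> (\<Union>v\<in>fvars \<phi>. tvars ((\<sigma>(x := Var z)) v)) - {z}"
    using Ex.IH[of "\<sigma>(x := Var z)"] by (simp only: fvars.simps Diff_mono subset_refl)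
  \<comment> \<open>The only new variable is \<open>z\<close>, contributed at \<open>x\<close>, and
    it has just been removed.\<close>
  also have "\<dots> \<subseteq> (\<Union>v\<in>fvars (Ex x \<phi>). tvars (\<sigma> v))"
    by (auto split: if_splits)
  finally show ?case .
qed

text \<open>The substitution lemma. It later turns a statement about arbitrary elements of
  \<open>A\<close> into one about a generating tuple.\<close>

lemma sat_subst_fm: "sat A s (subst_fm \<phi> \<sigma>) \<longleftrightarrow> sat A (\<lambda>v. eval_trm A s (\<sigma> v)) \<phi>"
proof (induction \<phi> arbitrary: s \<sigma>)
  case (Ex x \<phi>)
  define z where "z = (LEAST z. z \<notin> (\<Union>v\<in>fvars \<phi>. tvars (\<sigma> v)))"
  \<comment> \<open>Only finitely many variables are excluded, so the \<open>LEAST\<close> in the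
    definition really is fresh.\<close>
  have "finite (\<Union>v\<in>fvars \<phi>. tvars (\<sigma> v))"
    by (simp add: finite_fvars finite_tvars)
  then have z: "z \<notin> (\<Union>v\<in>fvars \<phi>. tvars (\<sigma> v))"
    unfolding z_def by (rule LeastI_ex[OF ex_new_if_finite[OF infinite_UNIV_nat]])
  \<comment> \<open>At \<open>x\<close> both assignments give \<open>a\<close>; elsewhere the terms
    do not contain \<open>z\<close>, so updating \<open>z\<close> leaves their values
    unchanged.\<close>
  have "sat A (\<lambda>v. eval_trm A (s(z := a)) ((\<sigma>(x := Var z)) v)) \<phi> \<longleftrightarrow>
      sat A ((\<lambda>v. eval_trm A s (\<sigma> v))(x := a)) \<phi>" for a
    by (rule sat_cong) (use z in \<open>auto intro!: eval_trm_cong\<close>)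
  moreover have "subst_fm (Ex x \<phi>) \<sigma> = Ex z (subst_fm \<phi> (\<sigma>(x := Var z)))"
    by (simp add: Let_def z_def)
  ultimately show ?case
    by (simp only: sat.simps Ex.IH)
qed (auto simp: sat_subst_atom)

section \<open>Elements of a generated substructure as values of terms\<close>

lemma generated_eq:
  "generated L A (s ` V) = {eval_trm A s t |t. wf_trm L t \<and> tvars t \<subseteq> V}"
proof (intro equalityI subsetI)
  fix x assume "x \<in> generated L A (s ` V)"
  then show "x \<in> {eval_trm A s t |t. wf_trm L t \<and> tvars t \<subseteq> V}"
  proof induction
    case (base x)
    then obtain v where "v \<in> V" "x = s v" by blast
    then show ?case by (intro CollectI exI[of _ "Var v"]) simp
  next
    case (app f xs)
    then have "\<forall>x\<in>set xs. \<exists>t. wf_trm L t \<and> tvars t \<subseteq> V \<and> eval_trm A s t = x" by fastforce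
    \<comment> \<open>One term is chosen per argument; applying \<open>f\<close> to the chosen terms
      gives a term for the new element.\<close>
    from bchoice[OF this]
    obtain tm where tm: "\<forall>x\<in>set xs. wf_trm L (tm x) \<and> tvars (tm x) \<subseteq> V \<and> eval_trm A s (tm x) = x"
      by blast
    have "map (eval_trm A s \<circ> tm) xs = xs" using tm by (simp add: map_idI)
    with tm app show ?case
      by (intro CollectI exI[of _ "Fn f (map tm xs)"]) auto
  qed
next
  fix x assume "x \<in> {eval_trm A s t |t. wf_trm L t \<and> tvars t \<subseteq> V}"
  then obtain t where "wf_trm L t" "tvars t \<subseteq> V" "x = eval_trm A s t" by blast
  then show "x \<in> generated L A (s ` V)"
  proof (induction t arbitrary: x)
    case (Fn f ts)
    then have "\<forall>x\<in>set (map (eval_trm A s) ts). x \<in> generated L A (s ` V)" by fastforce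
    with Fn.prems show ?case
      using generated.app[of f L "map (eval_trm A s) ts" A "s ` V"] by simp
  qed (auto intro: generated.base)
qed

lemma nth_image_lessThan: "nth xs ` {..<length xs} = set xs"
  by (auto simp: set_conv_nth)

text \<open>A choice of a name, in terms of the generators, for each element. Maps out of
  \<open>A\<close> are later defined by evaluating this name at another tuple.\<close>

lemma generates_terms:
  assumes "generates L A (set as)"
  obtains tm where "\<And>x. x \<in> universe A \<Longrightarrow>
    wf_trm L (tm x) \<and> tvars (tm x) \<subseteq> {..<length as} \<and> eval_trm A (nth as) (tm x) = x"
proof -
  have "universe A = {eval_trm A (nth as) t |t. wf_trm L t \<and> tvars t \<subseteq> {..<length as}}"
    using assms generated_eq[of L A "nth as" "{..<length as}"]
    by (simp add: generates_def nth_image_lessThan)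
  then have "\<forall>x\<in>universe A. \<exists>t. wf_trm L t \<and> tvars t \<subseteq> {..<length as} \<and> eval_trm A (nth as) t = x"
    by fastforce
  from bchoice[OF this] show ?thesis using that by blast
qed

section \<open>Homomorphisms\<close>

lemma hom_eval_trm:
  assumes "hom L A B h" "is_struct L A"
  shows "wf_trm L t \<Longrightarrow> s ` tvars t \<subseteq> universe A \<Longrightarrow> h (eval_trm A s t) = eval_trm B (\<lambda>v. h (s v)) t"
proof (induction t)
  case (Fn f ts)
  have "set (map (eval_trm A s) ts) \<subseteq> universe A"
    using Fn.prems assms(2) by (auto intro!: eval_trm_in_universe[of L])
  moreover have "map h (map (eval_trm A s) ts) = map (eval_trm B (\<lambda>v. h (s v))) ts"
    using Fn by fastforce
  ultimately show ?case
    using Fn.prems assms(1) by (simp add: hom_def del: map_map map_eq_conv)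
qed simp

lemma hom_sat_atom:
  assumes "hom L A B h" "is_struct L A" "wf_atom L e" "s ` avars e \<subseteq> universe A" "sat_atom A s e"
  shows "sat_atom B (\<lambda>v. h (s v)) e"
proof (cases e)
  case (Eq t u)
  then show ?thesis
    using assms hom_eval_trm[OF assms(1,2), of _ s] by (simp add: image_Un) metis
next
  case (Rel r ts)
  have "set (map (eval_trm A s) ts) \<subseteq> universe A"
    using Rel assms by (auto intro!: eval_trm_in_universe[of L])
  moreover have "map h (map (eval_trm A s) ts) = map (eval_trm B (\<lambda>v. h (s v))) ts"
    using Rel assms by (auto intro!: hom_eval_trm[OF assms(1,2)])
  moreover have "rinterp B r (map h xs)" if "set xs \<subseteq> universe A" "rinterp A r xs" "length xs = length ts" for xs
    using assms(1,3) Rel that by (simp add: hom_def)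
  ultimately show ?thesis
    using Rel assms(5) by (metis length_map sat_atom.simps(2))
qed

text \<open>A homomorphism preserves atomic formulas. In the other direction, injectivity reflects
  equations, and the last clause of \<open>automorphism\<close> reflects relations.\<close>

lemma automorphism_sat_atom:
  assumes "automorphism L A h" "is_struct L A" "wf_atom L e" "s ` avars e \<subseteq> universe A"
  shows "sat_atom A (\<lambda>v. h (s v)) e \<longleftrightarrow> sat_atom A s e"
proof
  have hom: "hom L A A h" and inj: "inj_on h (universe A)"
    using assms(1) by (auto simp: automorphism_def bij_betw_def)
  show "sat_atom A s e \<Longrightarrow> sat_atom A (\<lambda>v. h (s v)) e"
    using hom_sat_atom[OF hom] assms by blast
  assume sat: "sat_atom A (\<lambda>v. h (s v)) e"
  show "sat_atom A s e"
  proof (cases e)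
    case (Eq t u)
    then have "h (eval_trm A s t) = h (eval_trm A s u)"
      using assms sat by (simp add: hom_eval_trm[OF hom assms(2)] image_Un)
    then show ?thesis
      using Eq assms by (auto intro: inj_onD[OF inj] eval_trm_in_universe[of L])
  next
    case (Rel r ts)
    have "set (map (eval_trm A s) ts) \<subseteq> universe A"
      using Rel assms by (auto intro!: eval_trm_in_universe[of L])
    moreover have "map h (map (eval_trm A s) ts) = map (eval_trm A (\<lambda>v. h (s v))) ts"
      using Rel assms by (auto intro!: hom_eval_trm[OF hom assms(2)])
    ultimately show ?thesis
      using Rel assms sat by (simp add: automorphism_def del: map_map map_eq_conv)
  qed
qed

lemma automorphism_sat:
  assumes "automorphism L A h" "is_struct L A"
  shows "wf_fm L \<phi> \<Longrightarrow> s ` fvars \<phi> \<subseteq> universe A \<Longrightarrow> sat A (\<lambda>v. h (s v)) \<phi> \<longleftrightarrow> sat A s \<phi>"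
proof (induction \<phi> arbitrary: s)
  case (Atom e)
  then show ?case using automorphism_sat_atom[OF assms, of e s] by simp
next
  case (Neg \<phi>)
  then show ?case by simp
next
  case (Conj \<phi> \<psi>)
  then show ?case by (simp add: image_Un)
next
  case (Ex x \<phi>)
  have surj: "h ` universe A = universe A"
    using assms(1) by (simp add: automorphism_def bij_betw_def)
  have "sat A ((\<lambda>v. h (s v))(x := h a)) \<phi> \<longleftrightarrow> sat A (s(x := a)) \<phi>" if "a \<in> universe A" for a
  proof -
    have "(\<lambda>v. h (s v))(x := h a) = (\<lambda>v. h ((s(x := a)) v))" by auto
    moreover have "sat A (\<lambda>v. h ((s(x := a)) v)) \<phi> \<longleftrightarrow> sat A (s(x := a)) \<phi>"
      by (rule Ex.IH) (use Ex.prems that in auto)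
    ultimately show ?thesis by simp
  qed
  \<comment> \<open>By surjectivity every witness for the quantifier on the left has the form
    \<open>h a\<close>, so the two ranges of witnesses match.\<close>
  then have "(\<exists>b\<in>h ` universe A. sat A ((\<lambda>v. h (s v))(x := b)) \<phi>) \<longleftrightarrow> (\<exists>a\<in>universe A. sat A (s(x := a)) \<phi>)"
    by simp
  then show ?case unfolding surj by simp
qed

text \<open>The image of a homomorphism is closed under the function symbols, so it is everything
  once it contains a generating set.\<close>

lemma hom_surj_if_generates:
  assumes "hom L A B h" "generates L B X" "X \<subseteq> h ` universe A" "is_struct L A"
  shows "h ` universe A = universe B"
proof
  show "h ` universe A \<subseteq> universe B" using assms(1) by (simp add: hom_def)
  have "x \<in> h ` universe A" if "x \<in> generated L B X" for x
    using that
  proof induction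
    case (base x)
    then show ?case using assms(3) by blast
  next
    case (app f xs)
    from app.IH have "\<forall>x\<in>set xs. \<exists>y. y \<in> universe A \<and> x = h y" by blast
    from bchoice[OF this] obtain g where g: "\<forall>x\<in>set xs. g x \<in> universe A \<and> x = h (g x)"
      by blast
    define ys where "ys = map g xs"
    have "map (h \<circ> g) xs = xs" using g by (intro map_idI) simp
    then have ys: "xs = map h ys" "set ys \<subseteq> universe A" using g by (auto simp: ys_def)
    with app.hyps have "h (finterp A f ys) = finterp B f xs" "finterp A f ys \<in> universe A"
      using assms(1,4) by (auto simp: hom_def is_struct_def)
    then show ?case by (metis image_eqI)
  qed
  then show "universe B \<subseteq> h ` universe A"
    using assms(2) by (auto simp: generates_def)
qed

text \<open>When \<open>as\<close> generates \<open>A\<close>, this is the condition for the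
  assignment of \<open>bs\<close> to \<open>as\<close> to extend to a homomorphism.\<close>

definition atomic_type_le ::
  "('f, 'r) language \<Rightarrow> ('f, 'r, 'a) struct \<Rightarrow> 'a list \<Rightarrow> ('f, 'r, 'b) struct \<Rightarrow> 'b list \<Rightarrow> bool" where
  "atomic_type_le L A as B bs \<longleftrightarrow> (\<forall>e. wf_atom L e \<longrightarrow> avars e \<subseteq> {..<length as} \<longrightarrow>
     sat_atom A (nth as) e \<longrightarrow> sat_atom B (nth bs) e)"

lemma atomic_type_leD:
  "atomic_type_le L A as B bs \<Longrightarrow> wf_atom L e \<Longrightarrow> avars e \<subseteq> {..<length as} \<Longrightarrow>
    sat_atom A (nth as) e \<Longrightarrow> sat_atom B (nth bs) e"
  by (simp add: atomic_type_le_def)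

text \<open>The map sends the value of a chosen term at \<open>as\<close> to its value at
  \<open>bs\<close>. Each property required of it is the transfer of a single atomic formula true at
  \<open>as\<close>.\<close>

lemma hom_of_atomic_type_le:
  fixes A :: "('f, 'r, 'a) struct" and B :: "('f, 'r, 'b) struct"
  assumes gen: "generates L A (set as)" and "is_struct L A" "is_struct L B"
    and len: "length bs = length as" and bs: "set bs \<subseteq> universe B"
    and le: "atomic_type_le L A as B bs"
  obtains h where "hom L A B h" "map h as = bs"
proof -
  obtain tm where tm: "\<And>x. x \<in> universe A \<Longrightarrow>
      wf_trm L (tm x) \<and> tvars (tm x) \<subseteq> {..<length as} \<and> eval_trm A (nth as) (tm x) = x"
    using generates_terms[OF gen] by blast
  define h where "h x = eval_trm B (nth bs) (tm x)" for x
  have as: "set as \<subseteq> universe A" using gen by (simp add: generates_def)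
  have eval_tm: "map (eval_trm A (nth as) \<circ> tm) xs = xs" if "set xs \<subseteq> universe A" for xs
    using that tm by (intro map_idI) auto
  have "hom L A B h"
    unfolding hom_def
  proof (intro conjI ballI allI impI)
    have "nth bs ` {..<length as} \<subseteq> universe B"
      using bs len nth_image_lessThan[of bs] by simp
    then show "h ` universe A \<subseteq> universe B"
      unfolding h_def using tm \<open>is_struct L B\<close> by (blast intro!: eval_trm_in_universe)
  next
    fix f xs assume f: "f \<in> fsyms L" "set xs \<subseteq> universe A" "length xs = farity L f"
    \<comment> \<open>The name chosen for a function value may differ from the function symbol
      applied to the chosen names; this equation relates the two.\<close>
    let ?e = "Eq (tm (finterp A f xs)) (Fn f (map tm xs)) :: ('f, 'r, nat) atom"
    have "finterp A f xs \<in> universe A" using f \<open>is_struct L A\<close> by (simp add: is_struct_def)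
    then have "wf_atom L ?e" "avars ?e \<subseteq> {..<length as}" "sat_atom A (nth as) ?e"
      using f tm by (auto simp: subset_iff eval_tm)
    then have "sat_atom B (nth bs) ?e" by (rule atomic_type_leD[OF le])
    then show "h (finterp A f xs) = finterp B f (map h xs)" by (simp add: h_def[abs_def] comp_def)
  next
    fix r xs assume r: "r \<in> rsyms L" "set xs \<subseteq> universe A" "length xs = rarity L r" "rinterp A r xs"
    let ?e = "Rel r (map tm xs) :: ('f, 'r, nat) atom"
    have "wf_atom L ?e" "avars ?e \<subseteq> {..<length as}" "sat_atom A (nth as) ?e"
      using r tm by (auto simp: subset_iff eval_tm)
    then have "sat_atom B (nth bs) ?e" by (rule atomic_type_leD[OF le])
    then show "rinterp B r (map h xs)" by (simp add: h_def[abs_def] comp_def)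
  qed
  moreover have "map h as = bs"
  proof (rule nth_equalityI)
    fix i assume "i < length (map h as)"
    then have i: "i < length as" by simp
    \<comment> \<open>The name chosen for the generator \<open>as ! i\<close> may be a term other
      than \<open>Var i\<close>, so the two must be compared.\<close>
    let ?e = "Eq (tm (as ! i)) (Var i) :: ('f, 'r, nat) atom"
    have "as ! i \<in> universe A" using as i by auto
    then have "wf_atom L ?e" "avars ?e \<subseteq> {..<length as}" "sat_atom A (nth as) ?e"
      using i tm by auto
    then have "sat_atom B (nth bs) ?e" by (rule atomic_type_leD[OF le])
    then show "map h as ! i = bs ! i" using i by (simp add: h_def)
  qed (simp add: len)
  ultimately show ?thesis using that by blast
qed

section \<open>Finitely many atomic formulas determine the atomic type of a generating tuple\<close>

text \<open>The common consequence of the two alternatives in hypothesis (i): a presentation of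
  \<open>A\<close> on \<open>as\<close> whose universality is tested only on tuples of
  \<open>A\<close> itself.\<close>

definition relations_for ::
  "('f, 'r) language \<Rightarrow> ('f, 'r, 'a) struct \<Rightarrow> 'a list \<Rightarrow> ('f, 'r, nat) atom set \<Rightarrow> bool" where
  "relations_for L A as S \<longleftrightarrow>
     (\<forall>e\<in>S. wf_atom L e \<and> avars e \<subseteq> {..<length as} \<and> sat_atom A (nth as) e) \<and>
     (\<forall>bs. length bs = length as \<longrightarrow> set bs \<subseteq> universe A \<longrightarrow> (\<forall>e\<in>S. sat_atom A (nth bs) e) \<longrightarrow>
        atomic_type_le L A as A bs)"

section \<open>Renaming the variables of atomic formulas\<close>

lemma eval_map_trm: "eval_trm A s (map_trm (\<lambda>x. x) g t) = eval_trm A (\<lambda>v. s (g v)) t"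
proof (induction t)
  case (Fn f ts)
  then have "map (eval_trm A s \<circ> map_trm (\<lambda>x. x) g) ts = map (eval_trm A (\<lambda>v. s (g v))) ts"
    by simp
  then show ?case by (simp del: map_eq_conv)
qed simp

lemma sat_map_atom: "sat_atom A s (map_atom (\<lambda>x. x) (\<lambda>x. x) g e) = sat_atom A (\<lambda>v. s (g v)) e"
  by (cases e) (simp_all add: eval_map_trm comp_def)

lemma wf_map_trm: "wf_trm L (map_trm (\<lambda>x. x) g t) = wf_trm L t"
  by (induction t) auto

lemma wf_map_atom: "wf_atom L (map_atom (\<lambda>x. x) (\<lambda>x. x) g e) = wf_atom L e"
  by (cases e) (auto simp: wf_map_trm)

lemma tvars_map_trm: "tvars (map_trm (\<lambda>x. x) g t) = g ` tvars t"
  by (induction t) auto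

lemma avars_map_atom: "avars (map_atom (\<lambda>x. x) (\<lambda>x. x) g e) = g ` avars e"
  by (cases e) (auto simp: tvars_map_trm)

text \<open>All atomic formulas true at \<open>as\<close> form one system of equations; a finite
  subsystem with the same solutions serves as \<open>S\<close>.\<close>

lemma relations_for_if_equationally_noetherian:
  fixes A :: "('f, 'r, 'a) struct"
  assumes "equationally_noetherian L A"
    and as: "set as \<subseteq> universe A"
  obtains S where "finite S" "relations_for L A as S"
proof -
  define T where "T = {e. wf_atom L e \<and> avars e \<subseteq> {..<length as} \<and> sat_atom A (nth as) e}"
  \<comment> \<open>Variables become unknowns \<open>Inl i\<close>, so the equations have no
    coefficients.\<close>
  let ?m = "map_atom (\<lambda>x. x) (\<lambda>x. x) Inl :: ('f, 'r, nat) atom \<Rightarrow> ('f, 'r, nat + 'a) atom"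
  have sol: "solutions A (length as) (?m ` E) =
      {bs. length bs = length as \<and> set bs \<subseteq> universe A \<and> (\<forall>e\<in>E. sat_atom A (nth bs) e)}" for E
    by (auto simp: solutions_def sat_map_atom comp_def)
  have "\<forall>e\<in>?m ` T. equation_over L A (length as) e"
    by (auto simp: T_def equation_over_def wf_map_atom avars_map_atom)
  then obtain E where "E \<subseteq> ?m ` T" "finite E"
    and E: "solutions A (length as) E = solutions A (length as) (?m ` T)"
    using assms(1) unfolding equationally_noetherian_def by meson
  \<comment> \<open>The finite subsystem lies in the image of \<open>T\<close>, so it is the image
    of a finite set of original formulas.\<close>
  then obtain S where S: "S \<subseteq> T" "finite S" "E = ?m ` S"
    by (metis finite_subset_image)
  have "relations_for L A as S"
    unfolding relations_for_def
  proof (intro conjI allI impI)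
    show "\<forall>e\<in>S. wf_atom L e \<and> avars e \<subseteq> {..<length as} \<and> sat_atom A (nth as) e"
      using S(1) by (auto simp: T_def)
    fix bs assume "length bs = length as" "set bs \<subseteq> universe A" "\<forall>e\<in>S. sat_atom A (nth bs) e"
    then have "bs \<in> solutions A (length as) (?m ` T)"
      using E S(3) by (auto simp: sol)
    then show "atomic_type_le L A as A bs"
      by (simp add: sol T_def atomic_type_le_def)
  qed
  then show ?thesis using that S(2) by blast
qed

text \<open>The test structures in the definition of a presentation live on terms. A generating tuple
  provides a copy of \<open>A\<close> there, with one chosen term for each element.\<close>

lemma presented_by_self_hom:
  fixes A :: "('f, 'r, 'a) struct"
  assumes pres: "presented_by L Q A ds D" and Q: "\<forall>q\<in>Q. wf_quasi_identity L q"
    and len: "length cs = length ds" and cs: "set cs \<subseteq> universe A"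
    and sat: "\<forall>e\<in>D. sat_atom A (nth cs) e"
  obtains h where "hom L A A h" "map h ds = cs"
proof -
  have inQ: "in_quasivariety L Q A" and gen: "generates L A (set ds)"
    and D: "\<And>e. e \<in> D \<Longrightarrow> wf_atom L e \<and> avars e \<subseteq> {..<length ds}"
    and univ: "\<And>(B :: ('f, 'r, ('f, nat) trm) struct) bs. in_quasivariety L Q B \<Longrightarrow>
      length bs = length ds \<Longrightarrow> set bs \<subseteq> universe B \<Longrightarrow> (\<forall>e\<in>D. sat_atom B (nth bs) e) \<Longrightarrow>
      (\<exists>h. hom L A B h \<and> map h ds = bs)"
    using pres by (auto simp: presented_by_def)
  have A: "is_struct L A" using inQ by (simp add: in_quasivariety_def)
  obtain tm where tm: "\<And>x. x \<in> universe A \<Longrightarrow>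
      wf_trm L (tm x) \<and> tvars (tm x) \<subseteq> {..<length ds} \<and> eval_trm A (nth ds) (tm x) = x"
    using generates_terms[OF gen] by blast
  define ev where "ev = eval_trm A (nth ds)"
  have ev_tm: "ev (tm x) = x" if "x \<in> universe A" for x
    using tm that by (simp add: ev_def)
  \<comment> \<open>The structure of \<open>A\<close> is transported along \<open>tm\<close>, with
    inverse \<open>ev\<close>, so that \<open>ev\<close> is an isomorphism from \<open>B\<close> to
    \<open>A\<close>.\<close>
  define B :: "('f, 'r, ('f, nat) trm) struct" where
    "B = \<lparr>universe = tm ` universe A, finterp = \<lambda>f ts. tm (finterp A f (map ev ts)),
          rinterp = \<lambda>r ts. rinterp A r (map ev ts)\<rparr>"
  have map_ev: "set (map ev ts) \<subseteq> universe A" if "set ts \<subseteq> universe B" for ts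
    using that by (auto simp: B_def ev_tm)
  have B: "is_struct L B"
    using A map_ev by (auto simp: is_struct_def B_def)
  have hom_ev: "hom L B A ev"
    using map_ev A by (auto simp: hom_def B_def ev_tm is_struct_def)
  have ev_inj: "t = u" if "ev t = ev u" "t \<in> universe B" "u \<in> universe B" for t u
    using that by (auto simp: B_def ev_tm)
  \<comment> \<open>Atomic truth is both preserved and reflected by \<open>ev\<close>: it is
    injective on \<open>B\<close>, and the relations of \<open>B\<close> are pulled back along it.
    Hence the quasi-identities of \<open>Q\<close> pass from \<open>A\<close> to
    \<open>B\<close>.\<close>
  have sat_B: "sat_atom B s e \<longleftrightarrow> sat_atom A (\<lambda>v. ev (s v)) e"
    if e: "wf_atom L e" "s ` avars e \<subseteq> universe B" for s :: "nat \<Rightarrow> _" and e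
  proof (cases e)
    case (Eq t u)
    have "eval_trm B s t \<in> universe B" "eval_trm B s u \<in> universe B"
      using Eq e by (auto intro!: eval_trm_in_universe[OF B])
    then have "eval_trm B s t = eval_trm B s u \<longleftrightarrow> ev (eval_trm B s t) = ev (eval_trm B s u)"
      by (auto dest: ev_inj)
    then show ?thesis
      using Eq e by (simp add: hom_eval_trm[OF hom_ev B] image_Un)
  next
    case (Rel r ts)
    have "map ev (map (eval_trm B s) ts) = map (eval_trm A (\<lambda>v. ev (s v))) ts"
      using Rel e by (auto intro!: hom_eval_trm[OF hom_ev B])
    then show ?thesis using Rel by (simp add: B_def del: map_map map_eq_conv)
  qed
  have "sat_quasi_identity B q" if "q \<in> Q" for q
    unfolding sat_quasi_identity_def
  proof (intro allI impI)
    fix s assume s: "range s \<subseteq> universe B" "\<forall>p\<in>set (fst q). sat_atom B s p"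
    have wf: "\<forall>p\<in>set (fst q). wf_atom L p" "wf_atom L (snd q)"
      using Q that by (auto simp: wf_quasi_identity_def)
    have img: "s ` V \<subseteq> universe B" for V using s(1) by blast
    have "range (\<lambda>v. ev (s v)) \<subseteq> universe A"
      using s(1) hom_ev by (auto simp: hom_def)
    moreover have "\<forall>p\<in>set (fst q). sat_atom A (\<lambda>v. ev (s v)) p"
      using s(2) wf sat_B img by blast
    ultimately have "sat_atom A (\<lambda>v. ev (s v)) (snd q)"
      using inQ that by (simp add: in_quasivariety_def sat_quasi_identity_def)
    then show "sat_atom B s (snd q)" using wf sat_B img by blast
  qed
  with B have "in_quasivariety L Q B" by (simp add: in_quasivariety_def)
  moreover have "\<forall>e\<in>D. sat_atom B (nth (map tm cs)) e"
  proof
    fix e assume e: "e \<in> D"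
    have cs_A: "cs ! v \<in> universe A" if "v \<in> avars e" for v
      using D[OF e] that cs len by (metis lessThan_iff nth_mem subsetD)
    have "sat_atom A (\<lambda>v. ev (map tm cs ! v)) e \<longleftrightarrow> sat_atom A (nth cs) e"
      by (rule sat_atom_cong) (use D[OF e] cs_A len in \<open>auto simp: ev_tm subset_iff\<close>)
    then show "sat_atom B (nth (map tm cs)) e"
      using sat e D[OF e] cs_A len by (subst sat_B) (auto simp: B_def subset_iff)
  qed
  moreover have "set (map tm cs) \<subseteq> universe B" using cs by (auto simp: B_def)
  ultimately obtain h where h: "hom L A B h" "map h ds = map tm cs"
    using univ[of B "map tm cs"] len by auto
  \<comment> \<open>The universal property yields a map into the copy; composing with
    \<open>ev\<close> brings it back to \<open>A\<close>.\<close>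
  have "hom L A A (ev \<circ> h)"
    unfolding hom_def
  proof (intro conjI ballI allI impI)
    show "(ev \<circ> h) ` universe A \<subseteq> universe A"
      using h(1) hom_ev by (auto simp: hom_def)
  next
    fix f xs assume f: "f \<in> fsyms L" "set xs \<subseteq> universe A" "length xs = farity L f"
    then have "set (map h xs) \<subseteq> universe B" using h(1) by (auto simp: hom_def)
    then show "(ev \<circ> h) (finterp A f xs) = finterp A f (map (ev \<circ> h) xs)"
      using f h(1) hom_ev by (simp add: hom_def)
  next
    fix r xs assume r: "r \<in> rsyms L" "set xs \<subseteq> universe A" "length xs = rarity L r" "rinterp A r xs"
    then have "set (map h xs) \<subseteq> universe B" using h(1) by (auto simp: hom_def)
    moreover have "rinterp B r (map h xs)" using r h(1) by (simp add: hom_def)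
    ultimately show "rinterp A r (map (ev \<circ> h) xs)"
      by (simp add: B_def)
  qed
  moreover have "map (ev \<circ> h) ds = cs"
    using h(2) cs ev_tm by (simp add: map_map[symmetric] del: map_map) (simp add: map_idI subset_iff)
  ultimately show ?thesis using that by blast
qed

text \<open>Change of generators: if \<open>ds\<close> are the generators of the given presentation, \<open>d\<^sub>j = u\<^sub>j(a)\<close> and
  \<open>a\<^sub>i = t\<^sub>i(d)\<close>, then the relations \<open>e(u(x))\<close> together with \<open>x\<^sub>i = t\<^sub>i(u(x))\<close> present \<open>A\<close> on \<open>a\<close>.\<close>

lemma relations_for_if_finitely_presented:
  fixes A :: "('f, 'r, 'a) struct"
  assumes "finitely_presented_in L Q A" and A: "is_struct L A" and gen: "generates L A (set as)"
  obtains S where "finite S" "relations_for L A as S"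
proof -
  obtain ds D where Q: "\<forall>q\<in>Q. wf_quasi_identity L q" and D: "finite D" "presented_by L Q A ds D"
    using assms(1) by (auto simp: finitely_presented_in_def)
  have gen_ds: "generates L A (set ds)"
    and wf_D: "\<And>e. e \<in> D \<Longrightarrow> wf_atom L e \<and> avars e \<subseteq> {..<length ds} \<and> sat_atom A (nth ds) e"
    using D(2) by (auto simp: presented_by_def)
  obtain tm where tm: "\<And>x. x \<in> universe A \<Longrightarrow>
      wf_trm L (tm x) \<and> tvars (tm x) \<subseteq> {..<length ds} \<and> eval_trm A (nth ds) (tm x) = x"
    using generates_terms[OF gen_ds] by blast
  obtain um where um: "\<And>x. x \<in> universe A \<Longrightarrow>
      wf_trm L (um x) \<and> tvars (um x) \<subseteq> {..<length as} \<and> eval_trm A (nth as) (um x) = x"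
    using generates_terms[OF gen] by blast
  have as_A: "as ! i \<in> universe A" if "i < length as" for i
    using gen that by (auto simp: generates_def)
  have ds_A: "ds ! j \<in> universe A" if "j < length ds" for j
    using gen_ds that by (auto simp: generates_def)
  define u where "u j = um (ds ! j)" for j
  define t where "t i = tm (as ! i)" for i
  have u: "wf_trm L (u j)" "tvars (u j) \<subseteq> {..<length as}" "eval_trm A (nth as) (u j) = ds ! j"
    if "j < length ds" for j
    using um ds_A[OF that] by (auto simp: u_def)
  have t: "wf_trm L (t i)" "tvars (t i) \<subseteq> {..<length ds}" "eval_trm A (nth ds) (t i) = as ! i"
    if "i < length as" for i
    using tm as_A[OF that] by (auto simp: t_def)
  define S where
    "S = subst_atom u ` D \<union> (\<lambda>i. Eq (Var i) (subst_trm u (t i))) ` {..<length as}"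
  have "relations_for L A as S"
    unfolding relations_for_def
  proof (intro conjI allI impI ballI)
    fix e assume "e \<in> S"
    then consider d where "d \<in> D" "e = subst_atom u d"
      | i where "i < length as" "e = Eq (Var i) (subst_trm u (t i))"
      by (auto simp: S_def)
    then have "wf_atom L e \<and> avars e \<subseteq> {..<length as} \<and> sat_atom A (nth as) e"
    proof cases
      case 1
      have "sat_atom A (\<lambda>v. eval_trm A (nth as) (u v)) d \<longleftrightarrow> sat_atom A (nth ds) d"
        by (rule sat_atom_cong) (use wf_D[OF 1(1)] u in auto)
      with wf_D[OF 1(1)] u show ?thesis
        unfolding 1(2) sat_subst_atom avars_subst_atom by (auto intro!: wf_subst_atom)
    next
      case 2
      have "eval_trm A (\<lambda>v. eval_trm A (nth as) (u v)) (t i) = eval_trm A (nth ds) (t i)"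
        by (rule eval_trm_cong) (use t(2)[OF 2(1)] u in auto)
      with t[OF 2(1)] u 2(1) show ?thesis
        unfolding 2(2) by (auto simp: eval_subst_trm tvars_subst_trm intro!: wf_subst_trm)
    qed
    then show "wf_atom L e" "avars e \<subseteq> {..<length as}" "sat_atom A (nth as) e" by auto
  next
    fix bs assume len: "length bs = length as" and bs: "set bs \<subseteq> universe A"
      and sat: "\<forall>e\<in>S. sat_atom A (nth bs) e"
    \<comment> \<open>These are the intended images of \<open>ds\<close>. The substituted relations
      in \<open>S\<close> say exactly that \<open>cs\<close> satisfies \<open>D\<close>.\<close>
    define cs where "cs = map (\<lambda>j. eval_trm A (nth bs) (u j)) [0..<length ds]"
    have bs_A: "nth bs ` {..<length as} \<subseteq> universe A"
      using bs len nth_image_lessThan[of bs] by simp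
    have "set cs \<subseteq> universe A"
      using u bs_A by (fastforce simp: cs_def intro!: eval_trm_in_universe[OF A])
    moreover have "length cs = length ds" by (simp add: cs_def)
    moreover have "\<forall>e\<in>D. sat_atom A (nth cs) e"
    proof
      fix e assume e: "e \<in> D"
      then have "sat_atom A (nth bs) (subst_atom u e)" using sat by (auto simp: S_def)
      moreover have "sat_atom A (nth cs) e \<longleftrightarrow> sat_atom A (\<lambda>v. eval_trm A (nth bs) (u v)) e"
        by (rule sat_atom_cong) (use wf_D[OF e] in \<open>auto simp: cs_def\<close>)
      ultimately show "sat_atom A (nth cs) e" by (simp add: sat_subst_atom)
    qed
    ultimately obtain h where h: "hom L A A h" "map h ds = cs"
      using presented_by_self_hom[OF D(2) Q] by blast
    \<comment> \<open>Writing \<open>as ! i\<close> as the value of \<open>t i\<close> at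
      \<open>ds\<close>, the map \<open>h\<close> sends it to the value of \<open>t i\<close> at
      \<open>cs\<close>, which the second family of relations in \<open>S\<close> identifies with
      \<open>bs ! i\<close>.\<close>
    have h_as: "h (as ! i) = bs ! i" if i: "i < length as" for i
    proof -
      have "h (as ! i) = h (eval_trm A (nth ds) (t i))" using t i by simp
      also have "\<dots> = eval_trm A (\<lambda>v. h (ds ! v)) (t i)"
        using t[OF i] ds_A by (intro hom_eval_trm[OF h(1) A]) auto
      also have "\<dots> = eval_trm A (\<lambda>v. eval_trm A (nth bs) (u v)) (t i)"
      proof (rule eval_trm_cong)
        fix v assume "v \<in> tvars (t i)"
        then have v: "v < length ds" using t(2)[OF i] by auto
        then have "h (ds ! v) = cs ! v" using h(2) by (metis nth_map)
        then show "(\<lambda>v. h (ds ! v)) v = eval_trm A (nth bs) (u v)" using v by (simp add: cs_def)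
      qed
      also have "\<dots> = bs ! i"
        using sat i by (simp add: S_def eval_subst_trm image_Un ball_Un)
      finally show ?thesis .
    qed
    show "atomic_type_le L A as A bs"
      unfolding atomic_type_le_def
    proof (intro allI impI)
      fix e :: "('f, 'r, nat) atom"
      assume e: "wf_atom L e" "avars e \<subseteq> {..<length as}" "sat_atom A (nth as) e"
      have "sat_atom A (\<lambda>v. h (as ! v)) e"
        by (rule hom_sat_atom[OF h(1) A e(1) _ e(3)]) (use e(2) as_A in auto)
      moreover have "sat_atom A (\<lambda>v. h (as ! v)) e \<longleftrightarrow> sat_atom A (nth bs) e"
        by (rule sat_atom_cong) (use e(2) h_as in auto)
      ultimately show "sat_atom A (nth bs) e" by simp
    qed
  qed
  moreover have "finite S" using D(1) by (simp add: S_def)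
  ultimately show ?thesis using that by blast
qed

section \<open>Isolated types of generating tuples\<close>

primrec exs :: "nat \<Rightarrow> ('f, 'r) fm \<Rightarrow> ('f, 'r) fm" where
  "exs 0 \<phi> = \<phi>"
| "exs (Suc n) \<phi> = exs n (Ex n \<phi>)"

lemma wf_exs: "wf_fm L (exs n \<phi>) = wf_fm L \<phi>"
  by (induction n arbitrary: \<phi>) auto

lemma fvars_exs: "fvars (exs n \<phi>) = fvars \<phi> - {..<n}"
  by (induction n arbitrary: \<phi>) auto

lemma sat_exs:
  assumes "fvars \<phi> \<subseteq> {..<n}"
  shows "sat A s (exs n \<phi>) \<longleftrightarrow> (\<exists>as. length as = n \<and> set as \<subseteq> universe A \<and> sat A (nth as) \<phi>)"
proof -
  \<comment> \<open>Generalized for the induction: variables from \<open>n\<close> on are still read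
    from \<open>s\<close>, since they may be free in the formula there.\<close>
  have "sat A s (exs n \<phi>) \<longleftrightarrow> (\<exists>as. length as = n \<and> set as \<subseteq> universe A \<and>
      sat A (\<lambda>i. if i < n then as ! i else s i) \<phi>)" for \<phi>
  proof (induction n arbitrary: \<phi>)
    case (Suc n)
    \<comment> \<open>The innermost quantifier binds variable \<open>n\<close> and supplies the last
      entry of the longer tuple.\<close>
    have eq: "(\<lambda>i. if i < n then as ! i else s i)(n := a) =
        (\<lambda>i. if i < Suc n then (as @ [a]) ! i else s i)" if "length as = n" for as a
      using that by (auto simp: nth_append)
    show ?case (is "_ \<longleftrightarrow> ?R")
    proof -
      have "sat A s (exs (Suc n) \<phi>) \<longleftrightarrow> (\<exists>as a. length as = n \<and> set as \<subseteq> universe A \<and> a \<in> universe A \<and>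
          sat A (\<lambda>i. if i < Suc n then (as @ [a]) ! i else s i) \<phi>)"
        by (auto simp: Suc.IH eq cong: conj_cong)
      also have "\<dots> \<longleftrightarrow> ?R"
      proof
        assume ?R
        then obtain cs where cs: "length cs = Suc n" "set cs \<subseteq> universe A"
          "sat A (\<lambda>i. if i < Suc n then cs ! i else s i) \<phi>" by blast
        then obtain as a where "cs = as @ [a]" by (metis length_Suc_conv_rev)
        with cs show "\<exists>as a. length as = n \<and> set as \<subseteq> universe A \<and> a \<in> universe A \<and>
          sat A (\<lambda>i. if i < Suc n then (as @ [a]) ! i else s i) \<phi>"
          by auto
      next
        assume "\<exists>as a. length as = n \<and> set as \<subseteq> universe A \<and> a \<in> universe A \<and>
          sat A (\<lambda>i. if i < Suc n then (as @ [a]) ! i else s i) \<phi>"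
        then obtain as a where "length as = n" "set as \<subseteq> universe A" "a \<in> universe A"
          "sat A (\<lambda>i. if i < Suc n then (as @ [a]) ! i else s i) \<phi>" by blast
        then show ?R by (intro exI[of _ "as @ [a]"]) simp
      qed
      finally show ?thesis .
    qed
  qed simp
  moreover have "sat A (\<lambda>i. if i < n then as ! i else s i) \<phi> \<longleftrightarrow> sat A (nth as) \<phi>" for as
    by (rule sat_cong) (use assms in auto)
  ultimately show ?thesis by simp
qed

text \<open>Completeness of the theory: it contains the existential closure of \<open>\<phi>\<close>
  or its negation, according to which is true in \<open>A\<close>.\<close>

lemma model_exs_iff:
  assumes model: "is_model L (Th L A) B" and "is_struct L A"
    and \<phi>: "wf_fm L \<phi>" "fvars \<phi> \<subseteq> {..<n}"
  shows "(\<exists>bs. length bs = n \<and> set bs \<subseteq> universe B \<and> sat B (nth bs) \<phi>) \<longleftrightarrow>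
    (\<exists>as. length as = n \<and> set as \<subseteq> universe A \<and> sat A (nth as) \<phi>)" (is "?B \<longleftrightarrow> ?A")
proof -
  \<comment> \<open>As the universe of \<open>B\<close> is nonempty, there is an assignment at which
    to instantiate \<open>holds_in\<close>.\<close>
  obtain b where b: "b \<in> universe B"
    using model by (auto simp: is_model_def is_struct_def)
  have holds: "holds_in B \<psi>" if "\<psi> \<in> Th L A" for \<psi>
    using model that by (simp add: is_model_def)
  have holds_B: "sat B (\<lambda>_. b) \<psi>" if "holds_in B \<psi>" for \<psi>
    using that b by (auto simp: holds_in_def)
  show ?thesis
  proof (cases ?A)
    case True
    then have "exs n \<phi> \<in> Th L A"
      using \<phi> by (simp add: Th_def sentence_def wf_exs fvars_exs holds_in_def sat_exs)
    then have ?B using holds_B[OF holds] sat_exs[OF \<phi>(2)] by blast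
    with True show ?thesis by blast
  next
    case False
    then have "Neg (exs n \<phi>) \<in> Th L A"
      using \<phi> by (simp add: Th_def sentence_def wf_exs fvars_exs holds_in_def sat_exs)
    then have "\<not> ?B" using holds_B[OF holds] sat_exs[OF \<phi>(2)] sat.simps(2) by blast
    with False show ?thesis by blast
  qed
qed

text \<open>Every parameter from \<open>A\<close> is the value of a term at \<open>as\<close>.
  Substituting these terms reduces any formula with parameters to a formula about \<open>as\<close>,
  whose truth agrees with that at \<open>bs\<close>.\<close>

lemma elementary_embedding_if_same_type:
  fixes A :: "('f, 'r, 'a) struct" and B :: "('f, 'r, 'b) struct"
  assumes gen: "generates L A (set as)" and "is_struct L B"
    and len: "length bs = length as" and bs: "set bs \<subseteq> universe B"
    and type: "\<And>\<phi>. wf_fm L \<phi> \<Longrightarrow> fvars \<phi> \<subseteq> {..<length as} \<Longrightarrow> sat A (nth as) \<phi> \<longleftrightarrow> sat B (nth bs) \<phi>"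
  shows "\<exists>h. elementary_embedding L A B h"
proof -
  obtain tm where tm: "\<And>x. x \<in> universe A \<Longrightarrow>
      wf_trm L (tm x) \<and> tvars (tm x) \<subseteq> {..<length as} \<and> eval_trm A (nth as) (tm x) = x"
    using generates_terms[OF gen] by blast
  define h where "h x = eval_trm B (nth bs) (tm x)" for x
  have "elementary_embedding L A B h"
    unfolding elementary_embedding_def
  proof (intro conjI allI impI)
    have "nth bs ` {..<length as} \<subseteq> universe B"
      using bs len nth_image_lessThan[of bs] by simp
    then show "h ` universe A \<subseteq> universe B"
      unfolding h_def using tm \<open>is_struct L B\<close> by (blast intro!: eval_trm_in_universe)
  next
    fix \<phi> :: "('f, 'r) fm" and s :: "nat \<Rightarrow> 'a"
    assume \<phi>: "wf_fm L \<phi>" and s: "range s \<subseteq> universe A"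
    let ?\<psi> = "subst_fm \<phi> (tm \<circ> s)"
    have tm_s: "wf_trm L ((tm \<circ> s) v) \<and> tvars ((tm \<circ> s) v) \<subseteq> {..<length as} \<and>
        eval_trm A (nth as) ((tm \<circ> s) v) = s v" for v
      using tm s by auto
    have "wf_fm L ?\<psi>" using \<phi> tm_s by (intro wf_subst_fm) auto
    moreover have "fvars ?\<psi> \<subseteq> {..<length as}" using fvars_subst_fm[of \<phi> "tm \<circ> s"] tm_s by blast
    moreover have "sat A (nth as) ?\<psi> \<longleftrightarrow> sat A s \<phi>"
      by (simp only: sat_subst_fm tm_s)
    moreover have "sat B (nth bs) ?\<psi> \<longleftrightarrow> sat B (h \<circ> s) \<phi>"
      by (simp add: sat_subst_fm h_def comp_def)
    ultimately show "sat A s \<phi> \<longleftrightarrow> sat B (h \<circ> s) \<phi>" using type by blast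
  qed
  then show ?thesis by blast
qed

lemma prime_if_isolated:
  fixes A :: "('f, 'r, 'a) struct"
  assumes A: "is_struct L A" and gen: "generates L A (set as)"
    and \<psi>: "wf_fm L \<psi>" "fvars \<psi> \<subseteq> {..<length as}" "sat A (nth as) \<psi>"
    and isolated: "\<And>cs \<phi>. length cs = length as \<Longrightarrow> set cs \<subseteq> universe A \<Longrightarrow> sat A (nth cs) \<psi> \<Longrightarrow>
      wf_fm L \<phi> \<Longrightarrow> fvars \<phi> \<subseteq> {..<length as} \<Longrightarrow> sat A (nth cs) \<phi> \<longleftrightarrow> sat A (nth as) \<phi>"
  shows "prime_struct TYPE('b) L A"
  unfolding prime_struct_def
proof (intro allI impI)
  fix B :: "('f, 'r, 'b) struct"
  assume B: "is_model L (Th L A) B"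
  note transfer = model_exs_iff[OF B A, of _ "length as"]
  have as: "set as \<subseteq> universe A" using gen by (simp add: generates_def)
  obtain bs where bs: "length bs = length as" "set bs \<subseteq> universe B" "sat B (nth bs) \<psi>"
    using transfer[OF \<psi>(1,2)] \<psi>(3) as by blast
  \<comment> \<open>If \<phi> holds at \<open>bs\<close>, then \<open>Conj \<psi> \<phi>\<close> is
    realized in \<open>B\<close>, hence at some \<open>cs\<close> in \<open>A\<close>; isolation
    moves \<phi> from \<open>cs\<close> to \<open>as\<close>.\<close>
  have imp: "sat A (nth as) \<phi>" if \<phi>: "wf_fm L \<phi>" "fvars \<phi> \<subseteq> {..<length as}" "sat B (nth bs) \<phi>" for \<phi>
  proof -
    have "wf_fm L (Conj \<psi> \<phi>)" "fvars (Conj \<psi> \<phi>) \<subseteq> {..<length as}" "sat B (nth bs) (Conj \<psi> \<phi>)"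
      using \<psi> \<phi> bs by auto
    then obtain cs where "length cs = length as" "set cs \<subseteq> universe A" "sat A (nth cs) (Conj \<psi> \<phi>)"
      using transfer bs by blast
    with isolated \<phi> show ?thesis by auto
  qed
  \<comment> \<open>The converse implication is the same argument applied to
    \<open>Neg \<phi>\<close>.\<close>
  have "sat A (nth as) \<phi> \<longleftrightarrow> sat B (nth bs) \<phi>" if "wf_fm L \<phi>" "fvars \<phi> \<subseteq> {..<length as}" for \<phi>
    using imp[of \<phi>] imp[of "Neg \<phi>"] that by auto
  then show "\<exists>h. elementary_embedding L A B h"
    using elementary_embedding_if_same_type[OF gen _ bs(1,2)] B by (simp add: is_model_def)
qed

theorem theorem5p3:
  fixes L :: "('f, 'r) language"
    and A :: "('f, 'r, 'a) struct"
    and Q :: "('f, 'r) quasi_identity set"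
  assumes "finite_language L"
    and "is_struct L A"
    and "finitely_generated L A"
    and "finitely_presented_in L Q A \<or> equationally_noetherian L A"
    and "hopfian L A"
    and "\<exists>n. definable_generation L A n"
  shows "prime_struct TYPE('b) L A"
proof -
  note A = \<open>is_struct L A\<close>
  obtain \<phi> as where \<phi>: "wf_fm L \<phi>" "fvars \<phi> \<subseteq> {..<length as}" "sat A (nth as) \<phi>"
    and gen: "generates L A (set as)"
    and def_gen: "\<And>bs. length bs = length as \<Longrightarrow> set bs \<subseteq> universe A \<Longrightarrow> sat A (nth bs) \<phi> \<Longrightarrow>
      generates L A (set bs)"
    using assms(6) unfolding definable_generation_def by blast
  have as: "set as \<subseteq> universe A" using gen by (simp add: generates_def)
  obtain S where "finite S" and S: "relations_for L A as S"
    using assms(4) relations_for_if_finitely_presented[OF _ A gen, of Q]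
      relations_for_if_equationally_noetherian[OF _ as] by blast
  obtain es where es: "set es = S" using finite_list[OF \<open>finite S\<close>] by blast
  \<comment> \<open>Starting the fold at \<phi> gives a formula even when \<open>S\<close> is
    empty.\<close>
  define \<psi> where "\<psi> = foldr (\<lambda>e. Conj (Atom e)) es \<phi>"
  have wf_\<psi>: "wf_fm L \<psi> \<longleftrightarrow> (\<forall>e\<in>S. wf_atom L e) \<and> wf_fm L \<phi>"
    unfolding \<psi>_def es[symmetric] by (induction es) auto
  have fvars_\<psi>: "fvars \<psi> = \<Union> (avars ` S) \<union> fvars \<phi>"
    unfolding \<psi>_def es[symmetric] by (induction es) auto
  have sat_\<psi>: "sat A s \<psi> \<longleftrightarrow> (\<forall>e\<in>S. sat_atom A s e) \<and> sat A s \<phi>" for s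
    unfolding \<psi>_def es[symmetric] by (induction es) auto
  show ?thesis
  proof (rule prime_if_isolated[OF A gen, of \<psi>])
    show "wf_fm L \<psi>" "fvars \<psi> \<subseteq> {..<length as}" "sat A (nth as) \<psi>"
      using \<phi> S by (auto simp: wf_\<psi> fvars_\<psi> sat_\<psi> relations_for_def)
  next
    fix cs and \<theta> :: "('f, 'r) fm"
    assume cs: "length cs = length as" "set cs \<subseteq> universe A" "sat A (nth cs) \<psi>"
      and \<theta>: "wf_fm L \<theta>" "fvars \<theta> \<subseteq> {..<length as}"
    have "atomic_type_le L A as A cs" "generates L A (set cs)"
      using cs S def_gen by (auto simp: sat_\<psi> relations_for_def)
    then obtain h where h: "hom L A A h" "map h as = cs"
      using hom_of_atomic_type_le[OF gen A A cs(1,2)] by blast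
    \<comment> \<open>The image of \<open>h\<close> contains the generating tuple \<open>cs\<close>,
      so \<open>h\<close> is onto and the Hopf property applies.\<close>
    have "set cs \<subseteq> h ` universe A" unfolding h(2)[symmetric] using as by (simp add: image_mono)
    then have "automorphism L A h"
      using hom_surj_if_generates[OF h(1) \<open>generates L A (set cs)\<close> _ A] h(1) \<open>hopfian L A\<close>
      by (simp add: hopfian_def)
    moreover have "nth as ` fvars \<theta> \<subseteq> universe A"
      using \<theta>(2) as nth_image_lessThan[of as] by blast
    ultimately have "sat A (\<lambda>v. h (as ! v)) \<theta> \<longleftrightarrow> sat A (nth as) \<theta>"
      using automorphism_sat[OF _ A \<theta>(1)] by blast
    moreover have "sat A (\<lambda>v. h (as ! v)) \<theta> \<longleftrightarrow> sat A (nth cs) \<theta>"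
      by (rule sat_cong) (use \<theta>(2) h(2) in auto)
    ultimately show "sat A (nth cs) \<theta> \<longleftrightarrow> sat A (nth as) \<theta>" by simp
  qed
qed

end
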